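(* Let $A\in\mathbb{R}^{n\times n}$, and let $\mathcal{P}=\{x\in\mathbb{R}^n : Gx\le b\}$ be a polyhedron, where $G\in\mathbb{R}^{m\times n}$ and $b\in\mathbb{R}^m$. Assume that $\mathcal{P}$ is an invariant set for the continuous system $\dot{x}(t)=Ax(t)$, and let $x_k\in\mathcal{P}$. Then there exists $\tau(x_k)>0$ such that $x_{k+1}\in\mathcal{P}$ for all $\Delta t\in[0,\tau(x_k)]$, where $x_{k+1}=(I+\Delta t A)x_k$ is obtained by the forward Euler method.
   Context: The inequality $Gx\le b$ is componentwise. A set $\mathcal{S}$ is an invariant set for $\dot x(t)=Ax(t)$ if $x(0)\in\mathcal{S}$ implies $x(t)\in\mathcal{S}$ for all $t\ge0$. *)

theory Defs
  imports "HOL-Analysis.Analysis"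
begin

text \<open>The order on vectors is the library's componentwise order
  (\<open>x \<le> y \<longleftrightarrow> (\<forall>i. x $ i \<le> y $ i)\<close>).\<close>

definition ineq_polyhedron :: "real ^ 'n ^ 'm \<Rightarrow> real ^ 'm \<Rightarrow> (real ^ 'n) set" where
  "ineq_polyhedron G b = {x. G *v x \<le> b}"

text \<open>Trajectories live on \<open>[0, \<infinity>)\<close>; the derivative is one-sided at \<open>0\<close>, and the
  values of \<open>x\<close> at negative times are irrelevant.\<close>

definition solves_linear_system :: "real ^ 'n ^ 'n \<Rightarrow> (real \<Rightarrow> real ^ 'n) \<Rightarrow> bool" where
  "solves_linear_system A x \<longleftrightarrow>
     (\<forall>t\<ge>0. (x has_vector_derivative A *v x t) (at t within {0..}))"

definition invariant_set :: "real ^ 'n ^ 'n \<Rightarrow> (real ^ 'n) set \<Rightarrow> bool" where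
  "invariant_set A S \<longleftrightarrow>
     (\<forall>x. solves_linear_system A x \<longrightarrow> x 0 \<in> S \<longrightarrow> (\<forall>t\<ge>0. x t \<in> S))"

definition forward_euler_step :: "real ^ 'n ^ 'n \<Rightarrow> real \<Rightarrow> real ^ 'n \<Rightarrow> real ^ 'n" where
  "forward_euler_step A dt x = (mat 1 + dt *\<^sub>R A) *v x"

end

theory Submission
  imports Defs
begin

text \<open>
  The flow of \<open>x' = A x\<close> and the Euler step leave \<open>x\<^sub>k\<close> with the same velocity \<open>A x\<^sub>k\<close>, so
  invariance only has to be exploited to first order at time \<open>0\<close>. Consider one constraint
  \<open>G\<^sub>i \<bullet> x \<le> b\<^sub>i\<close>. If it is active at \<open>x\<^sub>k\<close>, then along the trajectory from \<open>x\<^sub>k\<close> the function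
  \<open>G\<^sub>i \<bullet> x(t)\<close> never exceeds its initial value, so its derivative at \<open>0\<close>, which is \<open>G\<^sub>i \<bullet> A x\<^sub>k\<close>,
  is nonpositive; the Euler step is affine in the step size and therefore respects this
  constraint for \<^emph>\<open>every\<close> nonnegative step (\<open>active_row_velocity_nonpos\<close>). If the
  constraint is inactive, continuity leaves room for a small step. Finitely many constraints
  admit a common step bound.

  Invariance speaks about solutions only, so a solution starting at \<open>x\<^sub>k\<close> has to be produced:
  it is the exponential series \<open>\<Sum>n. t^n / n! A^n x\<^sub>k\<close>, which is differentiated
  one coordinate at a time as a real power series (\<open>linear_system_solution_exists\<close>).
\<close>

lemma norm_matrix_iterate_le:
  fixes A :: "real ^ 'n ^ 'n"
  shows "norm (((*v) A ^^ n) v) \<le> onorm ((*v) A) ^ n * norm v"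
proof (induction n)
  case (Suc n)
  have "norm (A *v ((*v) A ^^ n) v) \<le> onorm ((*v) A) * norm (((*v) A ^^ n) v)"
    by (simp add: onorm)
  also have "\<dots> \<le> onorm ((*v) A) * (onorm ((*v) A) ^ n * norm v)"
    using Suc by (intro mult_left_mono) (auto simp: onorm_pos_le)
  finally show ?case by (simp add: mult.assoc)
qed simp

text \<open>Comparison with the scalar series \<open>\<Sum>n. (\<parallel>A\<parallel> \<bar>y\<bar>)^n / n!\<close>.\<close>
lemma summable_exponential_series_component:
  fixes A :: "real ^ 'n ^ 'n"
  shows "summable (\<lambda>n. (((*v) A ^^ n) v $ i / fact n) * y ^ n)"
proof (rule summable_comparison_test')
  show "summable (\<lambda>n. norm v * ((onorm ((*v) A) * \<bar>y\<bar>) ^ n / fact n))"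
    using summable_exp_generic[of "onorm ((*v) A) * \<bar>y\<bar>"]
    by (intro summable_mult) (simp add: divide_inverse mult.commute)
  show "norm ((((*v) A ^^ n) v $ i / fact n) * y ^ n)
          \<le> norm v * ((onorm ((*v) A) * \<bar>y\<bar>) ^ n / fact n)" if "n \<ge> 0" for n
  proof -
    have "\<bar>((*v) A ^^ n) v $ i\<bar> \<le> onorm ((*v) A) ^ n * norm v"
      using component_le_norm_cart norm_matrix_iterate_le order_trans by blast
    then have "\<bar>((*v) A ^^ n) v $ i\<bar> * (\<bar>y\<bar> ^ n / fact n)
        \<le> onorm ((*v) A) ^ n * norm v * (\<bar>y\<bar> ^ n / fact n)"
      by (rule mult_right_mono) simp
    then show ?thesis
      by (simp add: abs_mult power_abs power_mult_distrib mult_ac)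
  qed
qed

lemma has_real_derivative_exponential_series_component:
  fixes A :: "real ^ 'n ^ 'n" and v :: "real ^ 'n"
  defines "e \<equiv> \<lambda>j t. \<Sum>n. (((*v) A ^^ n) v $ j / fact n) * t ^ n"
  shows "(e i has_real_derivative (\<Sum>j\<in>UNIV. A $ i $ j * e j t)) (at t)"
proof -
  let ?c = "\<lambda>j n. ((*v) A ^^ n) v $ j / fact n"
  \<comment> \<open>Shifting the index turns \<open>A^(n + 1) v / n!\<close> into \<open>A\<close> applied to the \<open>n\<close>-th coefficient.\<close>
  have shift: "diffs (?c i) n = (\<Sum>j\<in>UNIV. A $ i $ j * ?c j n)" for n
  proof -
    have "diffs (?c i) n = (A *v ((*v) A ^^ n) v) $ i / fact n"
      by (simp add: diffs_def divide_simps)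
    then show ?thesis
      by (simp add: matrix_vector_mult_def sum_divide_distrib)
  qed
  have "(\<Sum>n. diffs (?c i) n * t ^ n) = (\<Sum>n. \<Sum>j\<in>UNIV. A $ i $ j * (?c j n * t ^ n))"
    unfolding shift by (simp add: sum_distrib_right mult.assoc)
  also have "\<dots> = (\<Sum>j\<in>UNIV. \<Sum>n. A $ i $ j * (?c j n * t ^ n))"
    by (intro suminf_sum summable_mult summable_exponential_series_component)
  also have "\<dots> = (\<Sum>j\<in>UNIV. A $ i $ j * e j t)"
    unfolding e_def
    by (intro sum.cong refl suminf_mult summable_exponential_series_component)
  finally have "(\<Sum>n. diffs (?c i) n * t ^ n) = (\<Sum>j\<in>UNIV. A $ i $ j * e j t)" .
  moreover have "(e i has_real_derivative (\<Sum>n. diffs (?c i) n * t ^ n)) (at t)"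
    unfolding e_def
    by (intro termdiffs_strong_converges_everywhere summable_exponential_series_component)
  ultimately show ?thesis by simp
qed

text \<open>
  The solution is \<open>e^(tA) v\<close>. In coordinates the vector-valued series becomes finitely many real
  power series with infinite radius of convergence, so termwise differentiation is the
  classical one and no uniform convergence argument for vector-valued series is needed.
\<close>
lemma linear_system_solution_exists:
  fixes A :: "real ^ 'n ^ 'n"
  obtains x where "solves_linear_system A x" "x 0 = v"
proof
  define e where "e = (\<lambda>j t. \<Sum>n. (((*v) A ^^ n) v $ j / fact n) * t ^ n)"
  let ?x = "\<lambda>t. \<chi> j. e j t"
  have "(?x has_vector_derivative A *v ?x t) (at t within {0..})" for t
    unfolding has_vector_derivative_def
  proof (subst has_derivative_componentwise_within, rule ballI)
    fix u :: "real ^ 'n" assume "u \<in> Basis"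
    then obtain i where u: "u = axis i 1"
      by (auto simp: Basis_vec_def)
    have "(e i has_real_derivative (A *v ?x t) $ i) (at t within {0..})"
      using has_real_derivative_exponential_series_component[where A = A and v = v and i = i and t = t]
      by (simp add: e_def matrix_vector_mult_def DERIV_subset[OF _ subset_UNIV])
    then show "((\<lambda>t. ?x t \<bullet> u) has_derivative (\<lambda>h. (h *\<^sub>R (A *v ?x t)) \<bullet> u))
        (at t within {0..})"
      by (simp add: u inner_axis has_field_derivative_def mult_commute_abs)
  qed
  then show "solves_linear_system A ?x"
    by (simp add: solves_linear_system_def)
  show "?x 0 = v"
    by (simp add: vec_eq_iff e_def powser_zero del: times_divide_eq_left)
qed

text \<open>
  Otherwise the trajectory from \<open>v\<close> would cross the face of the constraint immediately:
  a positive one-sided derivative at \<open>0\<close> makes \<open>G\<^sub>i \<bullet> x(t)\<close> exceed \<open>G\<^sub>i \<bullet> v = b\<^sub>i\<close>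
  for small \<open>t > 0\<close>.
\<close>
lemma active_row_velocity_nonpos:
  fixes A :: "real ^ 'n ^ 'n" and G :: "real ^ 'n ^ 'm"
  assumes inv: "invariant_set A (ineq_polyhedron G b)"
    and v: "v \<in> ineq_polyhedron G b"
    and active: "(G *v v) $ i = b $ i"
  shows "(G *v (A *v v)) $ i \<le> 0"
proof (rule ccontr)
  assume pos: "\<not> (G *v (A *v v)) $ i \<le> 0"
  obtain x where x: "solves_linear_system A x" "x 0 = v"
    by (rule linear_system_solution_exists)
  have bound: "(G *v x t) $ i \<le> b $ i" if "t \<ge> 0" for t
    using inv x v that
    by (auto simp: invariant_set_def ineq_polyhedron_def less_eq_vec_def)
  have "(x has_vector_derivative A *v v) (at 0 within {0..})"
    using x by (auto simp: solves_linear_system_def)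
  then have "((\<lambda>t. (G *v x t) $ i) has_vector_derivative (G *v (A *v v)) $ i) (at 0 within {0..})"
    by (intro bounded_linear.has_vector_derivative
        [OF bounded_linear_compose[OF bounded_linear_vec_nth matrix_vector_mul_bounded_linear]])
  then have "((\<lambda>t. (G *v x t) $ i) has_real_derivative (G *v (A *v v)) $ i) (at 0 within {0..})"
    by (simp add: has_real_derivative_iff_has_vector_derivative)
  then obtain d where d: "d > 0"
    and inc: "\<And>h. h > 0 \<Longrightarrow> h < d \<Longrightarrow> (G *v x 0) $ i < (G *v x h) $ i"
    using has_real_derivative_pos_inc_right[of "\<lambda>t. (G *v x t) $ i" _ 0 "{0..}"] pos
    by (metis add_0 atLeast_iff less_le not_le)
  show False
    using inc[of "d / 2"] bound[of "d / 2"] d x(2) active by simp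
qed

lemma forward_euler_step_row:
  "(G *v forward_euler_step A dt v) $ i = (G *v v) $ i + dt * (G *v (A *v v)) $ i"
  by (simp add: forward_euler_step_def matrix_vector_mult_add_rdistrib
      matrix_vector_right_distrib matrix_vector_mult_scaleR scaleR_matrix_vector_assoc[symmetric])

theorem lemma3p1:
  fixes A :: "real ^ 'n ^ 'n" and G :: "real ^ 'n ^ 'm" and b :: "real ^ 'm"
    and x\<^sub>k :: "real ^ 'n"
  assumes "invariant_set A (ineq_polyhedron G b)"
    and "x\<^sub>k \<in> ineq_polyhedron G b"
  shows "\<exists>\<tau>>0. \<forall>dt\<in>{0..\<tau>}. forward_euler_step A dt x\<^sub>k \<in> ineq_polyhedron G b"
proof -
  let ?s = "\<lambda>i. (G *v x\<^sub>k) $ i" and ?c = "\<lambda>i. (G *v (A *v x\<^sub>k)) $ i"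
  have feasible: "?s i \<le> b $ i" for i
    using assms(2) by (simp add: ineq_polyhedron_def less_eq_vec_def)
  have "\<forall>\<^sub>F dt in at_right 0. ?s i + dt * ?c i \<le> b $ i" for i
  proof (cases "?s i = b $ i")
    case True
    then have "?c i \<le> 0"
      using active_row_velocity_nonpos[OF assms] by blast
    then show ?thesis
      using True by (intro eventually_mono[OF eventually_at_right_less[of 0]])
        (simp add: mult_nonneg_nonpos)
  next
    case False
    have "((\<lambda>dt. ?s i + dt * ?c i) \<longlongrightarrow> ?s i + 0 * ?c i) (at_right 0)"
      by (intro tendsto_intros)
    moreover have "?s i + 0 * ?c i < b $ i"
      using False feasible[of i] by simp
    ultimately have "\<forall>\<^sub>F dt in at_right 0. ?s i + dt * ?c i < b $ i"
      by (rule order_tendstoD(2))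
    then show ?thesis
      by (rule eventually_mono) simp
  qed
  then have "\<forall>\<^sub>F dt in at_right 0. \<forall>i. ?s i + dt * ?c i \<le> b $ i"
    by (rule eventually_all_finite)
  then obtain d where d: "d > 0"
    and step: "\<And>dt i. 0 < dt \<Longrightarrow> dt < d \<Longrightarrow> ?s i + dt * ?c i \<le> b $ i"
    by (auto simp: eventually_at_right_field)
  show ?thesis
  proof (intro exI[of _ "d / 2"] conjI ballI)
    fix dt assume "dt \<in> {0..d / 2}"
    then have "?s i + dt * ?c i \<le> b $ i" for i
      \<comment> \<open>The right-sided neighbourhood omits \<open>dt = 0\<close>, where the step stays at \<open>x\<^sub>k\<close>.\<close>
      using step[of dt i] feasible[of i] d by (cases "dt = 0") auto
    then show "forward_euler_step A dt x\<^sub>k \<in> ineq_polyhedron G b"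
      by (simp add: ineq_polyhedron_def less_eq_vec_def forward_euler_step_row)
  qed (use d in simp)
qed

end
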